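(* For any group $G$, the following are equivalent: (1) $G$ is diffuse. (2) $G$ is weakly diffuse. (3) $G$ has a locally invariant total order. (4) $G$ has a locally invariant partial order.
   Context: A partial order on a group $G$ is a transitive, irreflexive binary relation $\prec$ on $G$ (write $x \succ y$ for $y \prec x$); it is a total order if for all $x \neq y$ in $G$ either $x \prec y$ or $x \succ y$. A partial order $\prec$ on $G$ is locally invariant if, for all $x, y \in G$ with $y \neq e$, either $xy \succ x$ or $xy^{-1} \succ x$. An element $a$ of a subset $A$ of $G$ is an extreme point of $A$ if, for all nonidentity $h \in G$, either $a h \notin A$ or $a h^{-1} \notin A$. $G$ is weakly diffuse if every nonempty finite subset of $G$ has an extreme point. $G$ is diffuse if every finite subset $A$ of $G$ with $\#A \ge 2$ has at least two extreme points. *)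

theory Defs
  imports "HOL-Algebra.Group"
begin

text \<open>
  Orders are strict, and \<open>prec x y\<close> stands for \<open>x \<prec> y\<close>. A relation on a group is represented by a
  predicate on the ambient type of which only the values on the carrier matter.
\<close>

definition strict_partial_order_on :: "'a set \<Rightarrow> ('a \<Rightarrow> 'a \<Rightarrow> bool) \<Rightarrow> bool" where
  "strict_partial_order_on A prec \<longleftrightarrow> transp_on A prec \<and> irreflp_on A prec"

definition strict_total_order_on :: "'a set \<Rightarrow> ('a \<Rightarrow> 'a \<Rightarrow> bool) \<Rightarrow> bool" where
  "strict_total_order_on A prec \<longleftrightarrow> strict_partial_order_on A prec \<and> totalp_on A prec"

definition locally_invariant :: "('a, 'b) monoid_scheme \<Rightarrow> ('a \<Rightarrow> 'a \<Rightarrow> bool) \<Rightarrow> bool" where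
  "locally_invariant G prec \<longleftrightarrow>
     (\<forall>x\<in>carrier G. \<forall>y\<in>carrier G. y \<noteq> \<one>\<^bsub>G\<^esub> \<longrightarrow>
        prec x (x \<otimes>\<^bsub>G\<^esub> y) \<or> prec x (x \<otimes>\<^bsub>G\<^esub> inv\<^bsub>G\<^esub> y))"

definition extreme_point :: "('a, 'b) monoid_scheme \<Rightarrow> 'a set \<Rightarrow> 'a \<Rightarrow> bool" where
  "extreme_point G A a \<longleftrightarrow> a \<in> A \<and>
     (\<forall>h\<in>carrier G. h \<noteq> \<one>\<^bsub>G\<^esub> \<longrightarrow> a \<otimes>\<^bsub>G\<^esub> h \<notin> A \<or> a \<otimes>\<^bsub>G\<^esub> inv\<^bsub>G\<^esub> h \<notin> A)"

definition weakly_diffuse :: "('a, 'b) monoid_scheme \<Rightarrow> bool" where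
  "weakly_diffuse G \<longleftrightarrow>
     (\<forall>A. A \<subseteq> carrier G \<and> finite A \<and> A \<noteq> {} \<longrightarrow> (\<exists>a. extreme_point G A a))"

definition diffuse :: "('a, 'b) monoid_scheme \<Rightarrow> bool" where
  "diffuse G \<longleftrightarrow>
     (\<forall>A. A \<subseteq> carrier G \<and> finite A \<and> card A \<ge> 2 \<longrightarrow>
        (\<exists>a b. a \<noteq> b \<and> extreme_point G A a \<and> extreme_point G A b))"

end

theory Submission
  imports Defs
begin

text \<open>
  A maximal element of a finite set, for a locally invariant partial order, is an extreme point.
  Conversely, removing extreme points one after the other orders a finite set from the top down so
  that each point is extreme among those below it; by compactness, such finite orders yield an
  order of the whole group.

  A finite set \<open>A\<close> with at least two elements cannot have a unique extreme point \<open>a\<close>, because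
  then no \<open>x\<inverse>y\<close> would be extreme in \<open>A\<inverse>A\<close>: if \<open>y \<noteq> a\<close>, move \<open>y\<close> inside \<open>A\<close>; if \<open>x \<noteq> a\<close>, move
  \<open>x\<close>, which multiplies \<open>x\<inverse>y\<close> on the left by some \<open>h\<close> or \<open>h\<inverse>\<close> and hence on the right by
  a conjugate; and if \<open>x = y = a\<close>, then \<open>x\<inverse>y = b\<inverse>b\<close> for another point \<open>b\<close>.
\<close>

section \<open>Compactness for total orders\<close>

lemma strict_total_order_on_subset:
  assumes "strict_total_order_on A prec" "B \<subseteq> A"
  shows "strict_total_order_on B prec"
  using assms unfolding strict_total_order_on_def strict_partial_order_on_def
  by (meson irreflp_on_subset totalp_on_subset transp_on_subset)

text \<open>By Zorn, take a maximal relation that on every finite subset of \<open>C\<close> is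
  contained in an admissible order of that subset. Maximality makes it total on \<open>C\<close>,
  and then it coincides with an admissible order on each finite set.\<close>

lemma strict_total_order_on_compactness:
  fixes Q :: "'a \<Rightarrow> 'a \<Rightarrow> 'a \<Rightarrow> bool"
  assumes fin: "\<And>F. finite F \<Longrightarrow> F \<subseteq> C \<Longrightarrow>
    \<exists>prec. strict_total_order_on F prec \<and>
      (\<forall>x\<in>F. \<forall>y\<in>F. \<forall>z\<in>F. Q x y z \<longrightarrow> prec x y \<or> prec x z)"
  shows "\<exists>prec. strict_total_order_on C prec \<and>
      (\<forall>x\<in>C. \<forall>y\<in>C. \<forall>z\<in>C. Q x y z \<longrightarrow> prec x y \<or> prec x z)"
proof -
  define ok where "ok F prec \<longleftrightarrow> strict_total_order_on F prec \<and>
      (\<forall>x\<in>F. \<forall>y\<in>F. \<forall>z\<in>F. Q x y z \<longrightarrow> prec x y \<or> prec x z)" for F prec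
  have ok_subset: "ok E prec" if "ok F prec" "E \<subseteq> F" for E F prec
    using that strict_total_order_on_subset[of F prec E] unfolding ok_def by blast
  define ext where "ext R F prec \<longleftrightarrow> ok F prec \<and> (\<forall>x\<in>F. \<forall>y\<in>F. (x, y) \<in> R \<longrightarrow> prec x y)" for R F prec
  have ext_subset: "ext R E prec" if "ext R F prec" "E \<subseteq> F" for R E F prec
    using that ok_subset[of F prec E] unfolding ext_def by blast
  define \<R> where "\<R> = {R. \<forall>F. finite F \<and> F \<subseteq> C \<longrightarrow> (\<exists>prec. ext R F prec)}"
  have "\<exists>M\<in>\<R>. \<forall>R\<in>\<R>. M \<subseteq> R \<longrightarrow> R = M"
  proof (rule subset_Zorn)
    fix K assume K: "subset.chain \<R> K"
    show "\<exists>U\<in>\<R>. \<forall>R\<in>K. R \<subseteq> U"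
    proof (cases "K = {}")
      case True
      have "{} \<in> \<R>"
        using fin unfolding \<R>_def ext_def ok_def by simp
      then show ?thesis using True by blast
    next
      case False
      have "\<Union>K \<in> \<R>"
        unfolding \<R>_def
      proof (intro CollectI allI impI)
        fix F assume F: "finite F \<and> F \<subseteq> C"
        \<comment> \<open>Only pairs inside \<open>F\<close> matter to \<open>ext\<close>. There are
          finitely many, so one member of the chain contains all those in the union, and its order
          on \<open>F\<close> serves for the union too.\<close>
        have "finite (\<Union>K \<inter> F \<times> F)" "\<Union>K \<inter> F \<times> F \<subseteq> \<Union>K"
          using F by auto
        then obtain R where R: "R \<in> K" "\<Union>K \<inter> F \<times> F \<subseteq> R"
          using finite_subset_Union_chain[OF _ _ False K] by metis
        then have "R \<in> \<R>"
          using K by (auto simp: subset_chain_def)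
        then obtain prec where "ext R F prec"
          using F unfolding \<R>_def by blast
        then have "ext (\<Union>K) F prec"
          using R(2) unfolding ext_def by blast
        then show "\<exists>prec. ext (\<Union>K) F prec" by blast
      qed
      then show ?thesis by blast
    qed
  qed
  then obtain M where M: "M \<in> \<R>" and max: "\<And>R. R \<in> \<R> \<Longrightarrow> M \<subseteq> R \<Longrightarrow> R = M"
    by blast
  have obstruct: "\<exists>F. finite F \<and> F \<subseteq> C \<and> (\<forall>prec. \<not> ext (insert (x, y) M) F prec)"
    if "(x, y) \<notin> M" for x y
    using that max[of "insert (x, y) M"] unfolding \<R>_def by blast
  have total: "(x, y) \<in> M \<or> (y, x) \<in> M" if xy: "x \<in> C" "y \<in> C" "x \<noteq> y" for x y
  proof (rule ccontr)
    assume "\<not> ?thesis"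
    then have "(x, y) \<notin> M" "(y, x) \<notin> M"
      by simp_all
    obtain E where E: "finite E" "E \<subseteq> C" "\<And>prec. \<not> ext (insert (x, y) M) E prec"
      using obstruct[OF \<open>(x, y) \<notin> M\<close>] by metis
    obtain F where F: "finite F" "F \<subseteq> C" "\<And>prec. \<not> ext (insert (y, x) M) F prec"
      using obstruct[OF \<open>(y, x) \<notin> M\<close>] by metis
    \<comment> \<open>An order extending \<open>M\<close> on this larger set has to compare
      \<open>x\<close> and \<open>y\<close>. Whichever way it does, its restriction to
      \<open>E\<close> or to \<open>F\<close> defies the obstruction found there.\<close>
    have "finite (insert x (insert y (E \<union> F)))" "insert x (insert y (E \<union> F)) \<subseteq> C"
      using E(1,2) F(1,2) xy(1,2) by auto
    then obtain prec where p: "ext M (insert x (insert y (E \<union> F))) prec"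
      using M unfolding \<R>_def by blast
    then have "prec x y \<or> prec y x"
      using \<open>x \<noteq> y\<close> unfolding ext_def ok_def strict_total_order_on_def totalp_on_def by blast
    moreover have "ext M E prec" "ext M F prec"
      using ext_subset[OF p] by blast+
    ultimately show False
      using E(3)[of prec] F(3)[of prec] unfolding ext_def by blast
  qed
  have agree: "\<exists>prec. ok F prec \<and> (\<forall>x\<in>F. \<forall>y\<in>F. (x, y) \<in> M \<longleftrightarrow> prec x y)"
    if F: "finite F" "F \<subseteq> C" for F
  proof -
    obtain prec where p: "ext M F prec"
      using M F unfolding \<R>_def by blast
    then have o: "transp_on F prec" "irreflp_on F prec"
      unfolding ext_def ok_def strict_total_order_on_def strict_partial_order_on_def by auto
    \<comment> \<open>Otherwise totality puts \<open>(y, x)\<close> into \<open>M\<close>, so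
      \<open>prec y x\<close> holds as well, against asymmetry.\<close>
    have "(x, y) \<in> M" if "x \<in> F" "y \<in> F" "prec x y" for x y
    proof -
      have "\<not> prec y x" "x \<noteq> y"
        using o that by (meson transp_onD irreflp_onD)+
      then show ?thesis
        using total[of x y] p that F unfolding ext_def by blast
    qed
    then show ?thesis
      using p unfolding ext_def by blast
  qed
  \<comment> \<open>Each of these conditions involves at most three points, so it is inherited from
    an admissible order on \<open>{x, y, z}\<close>.\<close>
  have *: "(Q x y z \<longrightarrow> (x, y) \<in> M \<or> (x, z) \<in> M) \<and> ((x, y) \<in> M \<longrightarrow> (y, z) \<in> M \<longrightarrow> (x, z) \<in> M)
      \<and> (x, x) \<notin> M"
    if "x \<in> C" "y \<in> C" "z \<in> C" for x y z
  proof -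
    have "finite {x, y, z}" "{x, y, z} \<subseteq> C"
      using that by auto
    then obtain prec where p: "ok {x, y, z} prec"
      "\<And>u v. u \<in> {x, y, z} \<Longrightarrow> v \<in> {x, y, z} \<Longrightarrow> (u, v) \<in> M \<longleftrightarrow> prec u v"
      using agree by meson
    then have "transp_on {x, y, z} prec" "irreflp_on {x, y, z} prec"
      unfolding ok_def strict_total_order_on_def strict_partial_order_on_def by auto
    then have "prec x y \<longrightarrow> prec y z \<longrightarrow> prec x z" "\<not> prec x x"
      using transp_onD[of "{x, y, z}" prec x y z] irreflp_onD[of "{x, y, z}" prec x] by simp_all
    moreover have "Q x y z \<longrightarrow> prec x y \<or> prec x z"
      using p(1) unfolding ok_def by blast
    ultimately show ?thesis
      using p(2)[of x y] p(2)[of y z] p(2)[of x z] p(2)[of x x] by simp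
  qed
  have "transp_on C (\<lambda>x y. (x, y) \<in> M)"
    by (rule transp_onI) (use * in metis)
  moreover have "irreflp_on C (\<lambda>x y. (x, y) \<in> M)"
    by (rule irreflp_onI) (use * in metis)
  moreover have "totalp_on C (\<lambda>x y. (x, y) \<in> M)"
    by (rule totalp_onI) (rule total)
  ultimately have "strict_total_order_on C (\<lambda>x y. (x, y) \<in> M)"
    unfolding strict_total_order_on_def strict_partial_order_on_def by blast
  moreover have "\<forall>x\<in>C. \<forall>y\<in>C. \<forall>z\<in>C. Q x y z \<longrightarrow> (x, y) \<in> M \<or> (x, z) \<in> M"
    using * by metis
  ultimately show ?thesis
    by (intro exI conjI)
qed

section \<open>Locally invariant orders and weak diffuseness\<close>

lemma (in group) partial_order_imp_weakly_diffuse: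
  assumes ord: "strict_partial_order_on (carrier G) prec" and inv: "locally_invariant G prec"
  shows "weakly_diffuse G"
  unfolding weakly_diffuse_def
proof (intro allI impI)
  fix A assume A: "A \<subseteq> carrier G \<and> finite A \<and> A \<noteq> {}"
  then have "transp_on A prec" "irreflp_on A prec"
    using ord unfolding strict_partial_order_on_def
    by (meson transp_on_subset irreflp_on_subset)+
  then have "asymp_on A prec"
    unfolding transp_on_def irreflp_on_def asymp_on_def by blast
  then obtain a where a: "a \<in> A" "\<forall>x\<in>A. x \<noteq> a \<longrightarrow> \<not> prec a x"
    using Finite_Set.bex_max_element[of A prec] A \<open>asymp_on A prec\<close> \<open>transp_on A prec\<close> by blast
  then have "\<not> prec a x" if "x \<in> A" for x
    using that \<open>irreflp_on A prec\<close> unfolding irreflp_on_def by (cases "x = a") auto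
  then have "extreme_point G A a"
    using a(1) A inv unfolding extreme_point_def locally_invariant_def by blast
  then show "\<exists>a. extreme_point G A a" ..
qed

text \<open>Induction on the set: remove an extreme point, order the rest, and put the removed point
  on top. Local invariance is phrased with separate \<open>y\<close> and \<open>z\<close> to match
  the constraint \<open>Q x y z\<close> of the compactness lemma.\<close>

lemma weakly_diffuse_finite_order:
  assumes wd: "weakly_diffuse G" and "finite A" "A \<subseteq> carrier G"
  shows "\<exists>prec. strict_total_order_on A prec \<and>
    (\<forall>x\<in>A. \<forall>y\<in>A. \<forall>z\<in>A.
       (\<exists>h\<in>carrier G. h \<noteq> \<one>\<^bsub>G\<^esub> \<and> y = x \<otimes>\<^bsub>G\<^esub> h \<and> z = x \<otimes>\<^bsub>G\<^esub> inv\<^bsub>G\<^esub> h) \<longrightarrow> prec x y \<or> prec x z)"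
  using assms(2,3)
proof (induction rule: finite_psubset_induct)
  case (psubset A)
  show ?case
  proof (cases "A = {}")
    case True
    then show ?thesis
      by (auto simp: strict_total_order_on_def strict_partial_order_on_def
          intro: transp_onI irreflp_onI totalp_onI)
  next
    case False
    then obtain a where a: "extreme_point G A a"
      using wd psubset.hyps psubset.prems unfolding weakly_diffuse_def by blast
    then have "a \<in> A"
      unfolding extreme_point_def by blast
    then obtain prec where p: "strict_total_order_on (A - {a}) prec"
      "\<And>x h. x \<in> A - {a} \<Longrightarrow> h \<in> carrier G \<Longrightarrow> h \<noteq> \<one>\<^bsub>G\<^esub> \<Longrightarrow>
         x \<otimes>\<^bsub>G\<^esub> h \<in> A - {a} \<Longrightarrow> x \<otimes>\<^bsub>G\<^esub> inv\<^bsub>G\<^esub> h \<in> A - {a} \<Longrightarrow>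
         prec x (x \<otimes>\<^bsub>G\<^esub> h) \<or> prec x (x \<otimes>\<^bsub>G\<^esub> inv\<^bsub>G\<^esub> h)"
      using psubset.IH[of "A - {a}"] psubset.prems by blast
    \<comment> \<open>With \<open>a\<close> on top, the constraint at \<open>x = a\<close> is
      vacuous by extremality. At another \<open>x\<close> it holds if one of the two neighbours is
      \<open>a\<close>, and otherwise comes from \<open>prec\<close>.\<close>
    define prec' where "prec' x y \<longleftrightarrow> x \<noteq> a \<and> (y = a \<or> prec x y)" for x y
    have "strict_total_order_on A prec'"
      using p(1)
      unfolding strict_total_order_on_def strict_partial_order_on_def prec'_def
        transp_on_def irreflp_on_def totalp_on_def by blast
    moreover have "prec' x (x \<otimes>\<^bsub>G\<^esub> h) \<or> prec' x (x \<otimes>\<^bsub>G\<^esub> inv\<^bsub>G\<^esub> h)"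
      if "x \<in> A" "h \<in> carrier G" "h \<noteq> \<one>\<^bsub>G\<^esub>" "x \<otimes>\<^bsub>G\<^esub> h \<in> A" "x \<otimes>\<^bsub>G\<^esub> inv\<^bsub>G\<^esub> h \<in> A" for x h
      using that a p(2)[of x h] unfolding prec'_def extreme_point_def by blast
    ultimately show ?thesis by blast
  qed
qed

text \<open>Compactness glues the finite orders. The carrier is closed under the operations, so the
  constraint applies to every pair \<open>x \<otimes> h\<close>, \<open>x \<otimes> inv h\<close>
  with \<open>h\<close> nonidentity.\<close>

lemma (in group) weakly_diffuse_imp_total_order:
  assumes wd: "weakly_diffuse G"
  shows "\<exists>prec. strict_total_order_on (carrier G) prec \<and> locally_invariant G prec"
proof -
  obtain prec where "strict_total_order_on (carrier G) prec"
    and "\<forall>x\<in>carrier G. \<forall>y\<in>carrier G. \<forall>z\<in>carrier G.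
       (\<exists>h\<in>carrier G. h \<noteq> \<one>\<^bsub>G\<^esub> \<and> y = x \<otimes>\<^bsub>G\<^esub> h \<and> z = x \<otimes>\<^bsub>G\<^esub> inv\<^bsub>G\<^esub> h) \<longrightarrow> prec x y \<or> prec x z"
    using strict_total_order_on_compactness[OF weakly_diffuse_finite_order[OF wd]] by blast
  moreover from this(2) have "locally_invariant G prec"
    unfolding locally_invariant_def by (blast intro: m_closed inv_closed)
  ultimately show ?thesis by blast
qed

section \<open>From one extreme point to two\<close>

lemma (in group) weakly_diffuse_imp_diffuse:
  assumes wd: "weakly_diffuse G"
  shows "diffuse G"
  unfolding diffuse_def
proof (intro allI impI)
  fix A assume A: "A \<subseteq> carrier G \<and> finite A \<and> card A \<ge> 2"
  then have "A \<noteq> {}" by auto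
  then obtain a where a: "extreme_point G A a"
    using wd A unfolding weakly_diffuse_def by blast
  then have "a \<in> A" unfolding extreme_point_def by blast
  show "\<exists>a b. a \<noteq> b \<and> extreme_point G A a \<and> extreme_point G A b"
  proof (rule ccontr)
    assume "\<not> ?thesis"
    then have "\<not> extreme_point G A x" if "x \<noteq> a" for x
      using a that by blast
    then have mid: "\<exists>h\<in>carrier G. h \<noteq> \<one> \<and> x \<otimes> h \<in> A \<and> x \<otimes> inv h \<in> A" if "x \<in> A" "x \<noteq> a" for x
      using that unfolding extreme_point_def by blast
    define C where "C = (\<lambda>(x, y). inv x \<otimes> y) ` (A \<times> A)"
    have C: "C \<subseteq> carrier G" "finite C" "C \<noteq> {}"
      using A \<open>A \<noteq> {}\<close> unfolding C_def by auto
    have CI: "inv x \<otimes> y \<in> C" if "x \<in> A" "y \<in> A" for x y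
      using that unfolding C_def by auto
    have right: "\<not> extreme_point G C (inv x \<otimes> y)" if xy: "x \<in> A" "y \<in> A" "y \<noteq> a" for x y
    proof -
      obtain h where h: "h \<in> carrier G" "h \<noteq> \<one>" "y \<otimes> h \<in> A" "y \<otimes> inv h \<in> A"
        using mid xy by blast
      have "x \<in> carrier G" "y \<in> carrier G" using A xy by auto
      then have "(inv x \<otimes> y) \<otimes> h \<in> C" "(inv x \<otimes> y) \<otimes> inv h \<in> C"
        using CI[OF xy(1) h(3)] CI[OF xy(1) h(4)] h(1) by (simp_all add: m_assoc)
      then show ?thesis
        using h(1,2) unfolding extreme_point_def by blast
    qed
    have left: "\<not> extreme_point G C (inv x \<otimes> y)" if xy: "x \<in> A" "y \<in> A" "x \<noteq> a" for x y
    proof -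
      obtain h where h: "h \<in> carrier G" "h \<noteq> \<one>" "x \<otimes> h \<in> A" "x \<otimes> inv h \<in> A"
        using mid xy by blast
      have xc: "x \<in> carrier G" and yc: "y \<in> carrier G" using A xy by auto
      define c where "c = inv x \<otimes> y"
      \<comment> \<open>The conjugate for which right multiplication of \<open>c\<close> by
        \<open>k\<close> is left multiplication by \<open>h\<close>; extremality in \<open>C\<close>
        only tests right multiplication.\<close>
      define k where "k = inv c \<otimes> h \<otimes> c"
      have cc: "c \<in> carrier G" "k \<in> carrier G"
        using xc yc h(1) unfolding c_def k_def by auto
      have ck: "c \<otimes> k = h \<otimes> c"
        using h(1) cc unfolding k_def by (simp add: m_assoc[symmetric])
      then have "k \<noteq> \<one>"
        using h(1,2) cc r_cancel_one by force
      moreover note ck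
      moreover have "c \<otimes> inv k = inv h \<otimes> c"
        using h(1) cc unfolding k_def by (simp add: inv_mult_group m_assoc[symmetric])
      \<comment> \<open>Inversion swaps the two moves of \<open>x\<close>: replacing
        \<open>x\<close> by \<open>x \<otimes> inv h\<close> turns \<open>c\<close> into
        \<open>h \<otimes> c\<close>, and replacing it by \<open>x \<otimes> h\<close> gives
        \<open>inv h \<otimes> c\<close>.\<close>
      moreover have "h \<otimes> c \<in> C" "inv h \<otimes> c \<in> C"
        using CI[OF h(4) xy(2)] CI[OF h(3) xy(2)] xc yc h(1)
        unfolding c_def by (simp_all add: inv_mult_group m_assoc)
      ultimately show ?thesis
        using cc unfolding extreme_point_def c_def[symmetric] by metis
    qed
    obtain b where b: "b \<in> A" "b \<noteq> a"
      using A by (metis card_le_Suc0_iff_eq not_less_eq_eq numeral_2_eq_2)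
    \<comment> \<open>The case \<open>x = y = a\<close> is reached by neither \<open>left\<close>
      nor \<open>right\<close> directly; rewriting the identity with \<open>b\<close> lets
      \<open>right\<close> apply.\<close>
    have "inv a \<otimes> a = inv b \<otimes> b"
      using A \<open>a \<in> A\<close> b by (metis l_inv subsetD)
    then have "\<not> extreme_point G C (inv x \<otimes> y)" if "x \<in> A" "y \<in> A" for x y
      using that left[of x y] right[of x y] right[OF b(1) b] by (cases "x = a"; cases "y = a") simp_all
    moreover obtain c where "extreme_point G C c"
      using wd C unfolding weakly_diffuse_def by blast
    moreover from this have "c \<in> C"
      unfolding extreme_point_def by blast
    ultimately show False
      unfolding C_def by auto
  qed
qed

lemma (in group) diffuse_imp_weakly_diffuse:
  assumes d: "diffuse G"
  shows "weakly_diffuse G"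
  unfolding weakly_diffuse_def
proof (intro allI impI)
  fix A assume A: "A \<subseteq> carrier G \<and> finite A \<and> A \<noteq> {}"
  show "\<exists>a. extreme_point G A a"
  proof (cases "card A \<ge> 2")
    case True
    then show ?thesis using d A unfolding diffuse_def by blast
  next
    case False
    then have "card A = 1"
      using A by (simp add: Suc_leI card_gt_0_iff le_antisym)
    then obtain a where "A = {a}" by (meson card_1_singletonE)
    \<comment> \<open>A nonidentity \<open>h\<close> moves \<open>a\<close>, so
      \<open>a \<otimes> h\<close> leaves the singleton.\<close>
    then have "extreme_point G A a"
      using A unfolding extreme_point_def by auto
    then show ?thesis ..
  qed
qed

theorem proposition6p2:
  fixes G :: "('a, 'b) monoid_scheme"
  assumes "group G"
  shows "(diffuse G \<longleftrightarrow> weakly_diffuse G)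
       \<and> (weakly_diffuse G \<longleftrightarrow>
            (\<exists>prec. strict_total_order_on (carrier G) prec \<and> locally_invariant G prec))
       \<and> ((\<exists>prec. strict_total_order_on (carrier G) prec \<and> locally_invariant G prec) \<longleftrightarrow>
            (\<exists>prec. strict_partial_order_on (carrier G) prec \<and> locally_invariant G prec))"
proof -
  \<comment> \<open>This closes the cycle from weak diffuseness through total and partial orders
    back to weak diffuseness.\<close>
  have "strict_partial_order_on (carrier G) prec" if "strict_total_order_on (carrier G) prec" for prec
    using that unfolding strict_total_order_on_def by blast
  then show ?thesis
    using group.diffuse_imp_weakly_diffuse[OF assms] group.weakly_diffuse_imp_diffuse[OF assms]
      group.weakly_diffuse_imp_total_order[OF assms] group.partial_order_imp_weakly_diffuse[OF assms]
    by blast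
qed

end
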